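(* Let $\lambda\in\mathbf R$. Assume $\boldsymbol\beta\in\mathbf B_{12}$ and $|\lambda|>\lambda_-$. Then the Rellich type theorem (RT) for $\hat H^D-\lambda$ fails; that is, there exists $\hat u\in\mathcal B_0^*(\mathbf Z^3;\mathbf C^6)$ such that $((\hat H^D-\lambda)\hat u)(n)=0$ for all $n$ outside a compact (finite) subset of $\mathbf Z^3$, but for no $R>0$ does $\hat u$ vanish on $\{n\in\mathbf Z^3:|n|>R\}$.
   Context: Parameters: $\epsilon_1,\epsilon_2,\epsilon_3,\mu_1,\mu_2,\mu_3\in(0,\infty)$; $\boldsymbol\epsilon=\mathrm{diag}(\epsilon_1,\epsilon_2,\epsilon_3)$, $\boldsymbol\mu=\mathrm{diag}(\mu_1,\mu_2,\mu_3)$, also identified with vectors. $\boldsymbol\beta=(\beta_1,\beta_2,\beta_3)=\boldsymbol\epsilon\times\boldsymbol\mu$ (cross product), and $\alpha_i=(\epsilon_j\mu_k+\epsilon_k\mu_j)/2$ for $(i,j,k)$ a cyclic permutation of $(1,2,3)$. $\mathbf B_{12}=\{\boldsymbol\beta\in\mathbf R^3:\boldsymbol\beta\ne0,\ \beta_1\beta_2\beta_3=0\}$. For $z\in[0,\infty)^3$: $\Psi_0(z)=\sum_i\alpha_iz_i$, $K_0(z)=\frac14\sum_{i=1}^3(\beta_iz_i)^2-\frac12\sum_{i<j}\beta_i\beta_jz_iz_j$ (which is $\ge 0$ there), $\tau^\pm(z)=\Psi_0(z)\pm\sqrt{K_0(z)}\ge0$, and $\lambda_\pm=\max_{z\in[0,1]^3}\sqrt{\tau^\pm(z)}$.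 Operators: for sequences on $\mathbf Z^3$ let $(\hat y_j\hat u)(n)=\frac1{2i}(\hat u(n+e_j)-\hat u(n-e_j))$ (this is multiplication by $y_j=\sin x_j$ under the Fourier convention $u(x)=(2\pi)^{-3/2}\sum_n e^{-in\cdot x}\hat u(n)$). The isotropic discrete Maxwell operator $\hat H_0$ acts on sequences $\hat u:\mathbf Z^3\to\mathbf C^6$ as the block matrix $\begin{pmatrix}0&\tilde M\\-\tilde M&0\end{pmatrix}$, $\tilde M=\begin{pmatrix}0&-\hat y_3&\hat y_2\\ \hat y_3&0&-\hat y_1\\-\hat y_2&\hat y_1&0\end{pmatrix}$. With $\hat D=\mathrm{diag}(\boldsymbol\epsilon,\boldsymbol\mu)$ ($6\times6$), the anisotropic operator is $\hat H^D=\hat D\hat H_0$. For $n\in\mathbf Z^3$, $|n|=\sum_j|n_j|$. $\mathcal B_0^*(\mathbf Z^3;\mathbf C^6)=\{\hat u:\mathbf Z^3\to\mathbf C^6:\ \lim_{R\to\infty}\frac1R\sum_{|n|<R}|\hat u(n)|^2=0\}$. *)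

theory Defs
  imports "HOL-Analysis.Analysis"
begin

definition beta :: "real^3 \<Rightarrow> real^3 \<Rightarrow> real^3" where
  "beta eps mu = cross3 eps mu"

definition alpha :: "real^3 \<Rightarrow> real^3 \<Rightarrow> real^3" where
  "alpha eps mu = vector
     [(eps$2 * mu$3 + eps$3 * mu$2) / 2,
      (eps$3 * mu$1 + eps$1 * mu$3) / 2,
      (eps$1 * mu$2 + eps$2 * mu$1) / 2]"

definition B12 :: "(real^3) set" where
  "B12 = {b. b \<noteq> 0 \<and> b$1 * b$2 * b$3 = 0}"

definition Psi0 :: "real^3 \<Rightarrow> real^3 \<Rightarrow> real^3 \<Rightarrow> real" where
  "Psi0 eps mu z = (\<Sum>i\<in>UNIV. alpha eps mu $ i * z$i)"

definition K0 :: "real^3 \<Rightarrow> real^3 \<Rightarrow> real^3 \<Rightarrow> real" where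
  "K0 eps mu z = (let b = beta eps mu in
     1/4 * (\<Sum>i\<in>UNIV. (b$i * z$i)\<^sup>2)
     - 1/2 * (b$1 * b$2 * z$1 * z$2 + b$1 * b$3 * z$1 * z$3 + b$2 * b$3 * z$2 * z$3))"

definition tau_minus :: "real^3 \<Rightarrow> real^3 \<Rightarrow> real^3 \<Rightarrow> real" where
  "tau_minus eps mu z = Psi0 eps mu z - sqrt (K0 eps mu z)"

definition unit_cube :: "(real^3) set" where
  "unit_cube = {z. \<forall>i. 0 \<le> z$i \<and> z$i \<le> 1}"

(* The maximum over the cube, attained by lambda_minus_is_max; the parameters are meant to have
   positive components, and then K0 and tau_minus are nonnegative on the cube. *)
definition lambda_minus :: "real^3 \<Rightarrow> real^3 \<Rightarrow> real" where
  "lambda_minus eps mu = (SUP z\<in>unit_cube. sqrt (tau_minus eps mu z))"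

lemma lambda_minus_is_max:
  shows "\<exists>z\<in>unit_cube. lambda_minus eps mu = sqrt (tau_minus eps mu z)"
    and "z \<in> unit_cube \<Longrightarrow> sqrt (tau_minus eps mu z) \<le> lambda_minus eps mu"
proof -
  let ?f = "\<lambda>z. sqrt (tau_minus eps mu z)"
  have cube: "unit_cube = cbox 0 1"
    by (auto simp: unit_cube_def mem_box_cart)
  have "continuous_on unit_cube ?f"
    unfolding tau_minus_def Psi0_def K0_def Let_def by (intro continuous_intros)
  moreover have "compact unit_cube"
    unfolding cube by (rule compact_cbox)
  moreover have "(0::real^3) \<in> unit_cube"
    by (simp add: unit_cube_def)
  ultimately obtain w where w: "w \<in> unit_cube" "\<And>z. z \<in> unit_cube \<Longrightarrow> ?f z \<le> ?f w"
    by (metis continuous_attains_sup empty_iff)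
  then have "lambda_minus eps mu = ?f w"
    unfolding lambda_minus_def by (intro cSup_eq_maximum) auto
  with w show "\<exists>z\<in>unit_cube. lambda_minus eps mu = ?f z"
    and "z \<in> unit_cube \<Longrightarrow> ?f z \<le> lambda_minus eps mu"
    by auto
qed

(* Multiplication by sin x_j under u(x) = (2 pi)^(-3/2) * sum over n of exp (-i n.x) u^(n). *)
definition y_hat :: "3 \<Rightarrow> (int^3 \<Rightarrow> complex) \<Rightarrow> int^3 \<Rightarrow> complex" where
  "y_hat j u n = (u (n + axis j 1) - u (n - axis j 1)) / (2 * \<i>)"

definition M_tilde :: "(int^3 \<Rightarrow> complex^3) \<Rightarrow> int^3 \<Rightarrow> complex^3" where
  "M_tilde u n = (let y = (\<lambda>j k. y_hat j (\<lambda>m. u m $ k) n) in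
     vector [          - y 3 2 + y 2 3,
              y 3 1            - y 1 3,
            - y 2 1 + y 1 2          ])"

(* upper, lower and join realise the splitting C^6 = C^3 + C^3 behind the 2 x 2 block notation. *)
definition upper :: "'a::zero^6 \<Rightarrow> 'a^3" where
  "upper v = vector [v$1, v$2, v$3]"

definition lower :: "'a::zero^6 \<Rightarrow> 'a^3" where
  "lower v = vector [v$4, v$5, v$6]"

definition join :: "'a::zero^3 \<Rightarrow> 'a^3 \<Rightarrow> 'a^6" where
  "join a b = vector [a$1, a$2, a$3, b$1, b$2, b$3]"

lemma forall_6: "(\<forall>i::6. P i) \<longleftrightarrow> P 1 \<and> P 2 \<and> P 3 \<and> P 4 \<and> P 5 \<and> P 6"
proof -
  have "(UNIV :: 6 set) = {1, 2, 3, 4, 5, 6}"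
    by (rule sym, rule card_seteq) simp_all
  then have "(\<forall>i\<in>(UNIV :: 6 set). P i) \<longleftrightarrow> (\<forall>i\<in>{1, 2, 3, 4, 5, 6}. P i)"
    by (rule arg_cong)
  then show ?thesis
    by simp
qed

lemma join_nth [simp]:
  "join a b $ 1 = a$1" "join a b $ 2 = a$2" "join a b $ 3 = a$3"
  "join a b $ 4 = b$1" "join a b $ 5 = b$2" "join a b $ 6 = b$3"
  by (simp_all add: join_def vector_def)

lemma join_upper_lower: "join (upper v) (lower v) = v"
  by (simp add: vec_eq_iff forall_6 upper_def lower_def)

definition H0 :: "(int^3 \<Rightarrow> complex^6) \<Rightarrow> int^3 \<Rightarrow> complex^6" where
  "H0 u n = join (M_tilde (\<lambda>m. lower (u m)) n) (- M_tilde (\<lambda>m. upper (u m)) n)"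

definition D_hat :: "real^3 \<Rightarrow> real^3 \<Rightarrow> complex^6^6" where
  "D_hat eps mu = (\<chi> i j. if i = j then complex_of_real (join eps mu $ i) else 0)"

definition HD :: "real^3 \<Rightarrow> real^3 \<Rightarrow> (int^3 \<Rightarrow> complex^6) \<Rightarrow> int^3 \<Rightarrow> complex^6" where
  "HD eps mu u n = D_hat eps mu *v H0 u n"

definition l1 :: "int^3 \<Rightarrow> int" where
  "l1 n = (\<Sum>j\<in>UNIV. \<bar>n$j\<bar>)"

lemma finite_l1_ball: "finite {n. real_of_int (l1 n) < R}"
proof (rule finite_subset)
  let ?S = "{- \<lceil>R\<rceil>..\<lceil>R\<rceil>}"
  show "{n. real_of_int (l1 n) < R} \<subseteq> (\<lambda>(a, b, c). vector [a, b, c]) ` (?S \<times> ?S \<times> ?S)"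
  proof
    fix n :: "int^3"
    assume "n \<in> {n. real_of_int (l1 n) < R}"
    then have "l1 n \<le> \<lceil>R\<rceil>"
      by (simp add: le_ceiling_iff)
    then have "n$1 \<in> ?S" "n$2 \<in> ?S" "n$3 \<in> ?S"
      by (auto simp: l1_def sum_3)
    moreover have "n = vector [n$1, n$2, n$3]"
      by (simp add: vec_eq_iff forall_3)
    ultimately show "n \<in> (\<lambda>(a, b, c). vector [a, b, c]) ` (?S \<times> ?S \<times> ?S)"
      by (auto intro!: image_eqI[where x = "(n$1, n$2, n$3)"])
  qed
qed simp

definition B0_star :: "(int^3 \<Rightarrow> complex^6) set" where
  "B0_star = {u. ((\<lambda>R::real. 1 / R * (\<Sum>n | real_of_int (l1 n) < R. (norm (u n))\<^sup>2)) \<longlongrightarrow> 0) at_top}"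

end

(* When some beta_i vanishes the medium is uniaxial and tau_+- are linear in z_j = sin^2 x_j: the
   Maxwell system splits into transverse electric and transverse magnetic modes, each governed by
   one scalar symbol p(z) with positive coefficients. The smaller symbol has maximum lambda_-^2 < lambda^2
   on the cube, so lambda^2 - p is invertible, and its inverse applied to a delta, inserted into the
   mode ansatz, gives a square summable field with a finitely supported residual.
   Conjugating with i^(n_1+n_2+n_3) turns y_j into the averaging operator over the two neighbours
   in direction j, hence the inverse into a Neumann series with nonnegative terms. It converges in
   l^1, and positivity shows that no cancellation makes the solution vanish far out. *)
theory Submission imports Defs begin

section \<open>Averaging operators and a nonnegative Green function\<close>

definition avg :: "3 \<Rightarrow> (int^3 \<Rightarrow> real) \<Rightarrow> int^3 \<Rightarrow> real" where
  "avg j g n = (g (n + axis j 1) + g (n - axis j 1)) / 2"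

lemma avg_nonneg: "(\<And>n. 0 \<le> g n) \<Longrightarrow> 0 \<le> avg j g n"
  by (simp add: avg_def)

lemma avg_linear:
  "avg j (\<lambda>n. f n + g n) = (\<lambda>n. avg j f n + avg j g n)"
  "avg j (\<lambda>n. f n - g n) = (\<lambda>n. avg j f n - avg j g n)"
  "avg j (\<lambda>n. - g n) = (\<lambda>n. - avg j g n)"
  "avg j (\<lambda>n. a * g n) = (\<lambda>n. a * avg j g n)"
  "avg j (\<lambda>n. g n / a) = (\<lambda>n. avg j g n / a)"
  "avg j (\<lambda>n. 0) = (\<lambda>n. 0)"
  by (simp_all add: avg_def fun_eq_iff algebra_simps add_divide_distrib diff_divide_distrib)

lemma avg_commute: "avg j (avg k g) = avg k (avg j g)"
  by (simp add: avg_def fun_eq_iff algebra_simps add_divide_distrib)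

lemma has_sum_shift:
  fixes g :: "'a::ab_group_add \<Rightarrow> 'b::{comm_monoid_add, topological_space}"
  assumes "(g has_sum s) UNIV"
  shows "((\<lambda>n. g (n + a)) has_sum s) UNIV"
proof -
  have "bij_betw (\<lambda>n. n + a) UNIV UNIV"
    by (simp add: bij_plus_right)
  from has_sum_reindex_bij_betw[OF this, of g s] assms show ?thesis
    by simp
qed

lemma avg_has_sum:
  assumes "(g has_sum s) UNIV"
  shows "(avg j g has_sum s) UNIV"
proof -
  have "((\<lambda>n. (1/2) * (g (n + axis j 1) + g (n + - axis j 1))) has_sum (1/2) * (s + s)) UNIV"
    by (intro has_sum_cmult_right has_sum_add has_sum_shift assms)
  then show ?thesis
    by (simp add: avg_def[abs_def])
qed

lemma avg_summable: "g summable_on UNIV \<Longrightarrow> avg j g summable_on UNIV"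
  using avg_has_sum by (auto simp: summable_on_def)

text \<open>\<open>avg j\<close> is multiplication by \<open>cos x_j\<close>, so this is the
  operator with symbol the sum of \<open>c j * (cos x_j)^2\<close>: the scalar mode symbol after the
  phase conjugation, which exchanges sine and cosine up to sign.\<close>

definition avg2 :: "(3 \<Rightarrow> real) \<Rightarrow> (int^3 \<Rightarrow> real) \<Rightarrow> int^3 \<Rightarrow> real" where
  "avg2 c g n = (\<Sum>j\<in>UNIV. c j * avg j (avg j g) n)"

text \<open>Averaging preserves total mass, so each application of \<open>avg2 c\<close> multiplies
  the mass by the sum of the weights; the delta starts with mass 1.\<close>

lemma avg2_power_has_sum:
  "(((avg2 c ^^ k) (\<lambda>n. of_bool (n = 0))) has_sum (\<Sum>j\<in>UNIV. c j) ^ k) UNIV"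
proof (induction k)
  case 0
  have "((\<lambda>n::int^3. of_bool (n = 0) :: real) has_sum 1) UNIV \<longleftrightarrow> ((\<lambda>n. 1::real) has_sum 1) {0::int^3}"
    by (rule has_sum_cong_neutral) auto
  then show ?case
    using has_sum_finite[of "{0::int^3}" "\<lambda>_. 1::real"] by simp
next
  case (Suc k)
  let ?q = "(avg2 c ^^ k) (\<lambda>n. of_bool (n = 0))"
  have "((\<lambda>n. \<Sum>j\<in>UNIV. c j * avg j (avg j ?q) n) has_sum (\<Sum>j\<in>UNIV. c j * s)) UNIV"
    if "(?q has_sum s) UNIV" for s
    unfolding sum_3 by (intro has_sum_add has_sum_cmult_right avg_has_sum that)
  from this[OF Suc.IH] show ?case
    by (simp add: avg2_def[abs_def] sum_distrib_right)
qed

text \<open>\<open>G\<close> is the Neumann series of \<open>avg2 c ^^ k\<close> applied to the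
  delta and divided by \<open>L ^ Suc k\<close>; the masses of its terms are geometric with ratio
  below 1. Positivity at the even axis points later supplies the infinite support.\<close>

lemma green_function:
  fixes c :: "3 \<Rightarrow> real"
  assumes c: "\<And>j. 0 < c j" and L: "(\<Sum>j\<in>UNIV. c j) < L"
  obtains G where "\<And>n. 0 \<le> G n" "G summable_on UNIV"
    "\<And>n. L * G n = avg2 c G n + of_bool (n = 0)"
    "\<And>j m. 0 < G (axis j (2 * int m))"
proof -
  define C where "C = (\<Sum>j\<in>UNIV. c j)"
  define q where "q k = (avg2 c ^^ k) (\<lambda>n. of_bool (n = 0))" for k
  have C0: "0 < C"
    unfolding C_def by (intro sum_pos c) auto
  have CL: "C < L" "0 < L"
    using L C0 by (auto simp: C_def)
  have q_Suc: "q (Suc k) = avg2 c (q k)" for k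
    by (simp add: q_def)
  have q_nonneg: "0 \<le> q k n" for k n
  proof (induction k arbitrary: n)
    case (Suc k)
    show ?case
      unfolding q_Suc avg2_def
      by (intro sum_nonneg mult_nonneg_nonneg avg_nonneg less_imp_le[OF c] Suc.IH)
  qed (simp add: q_def)
  have q_sum: "(q k has_sum C ^ k) UNIV" for k
    unfolding q_def C_def by (rule avg2_power_has_sum)
  have q_fin: "(\<Sum>n\<in>F. q k n) \<le> C ^ k" if "finite F" for k F
    using finite_sum_le_infsum[of "q k" UNIV F] q_sum[of k] that q_nonneg
    by (auto simp: has_sum_imp_summable infsumI)
  have q_le: "q k n \<le> C ^ k" for k n
    using q_fin[of "{n}" k] by simp
  define r where "r k n = q k n / L ^ Suc k" for k n
  have r_nonneg: "0 \<le> r k n" for k n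
    using CL by (simp add: r_def q_nonneg)
  have geo: "summable (\<lambda>k. C ^ k / L ^ Suc k)"
  proof -
    have "summable (\<lambda>k. (1 / L) * (C / L) ^ k)"
      using C0 CL by (intro summable_mult summable_geometric) auto
    then show ?thesis
      by (simp add: power_divide)
  qed
  have r_summable: "summable (\<lambda>k. r k n)" for n
  proof (rule summable_comparison_test'[OF geo])
    show "norm (r k n) \<le> C ^ k / L ^ Suc k" for k
      using q_nonneg[of k n] q_le[of k n] CL by (simp add: r_def divide_right_mono)
  qed
  define G where "G n = (\<Sum>k. r k n)" for n
  have G_sums: "(\<lambda>k. r k n) sums G n" for n
    using r_summable by (simp add: G_def summable_sums)
  have G_nonneg: "0 \<le> G n" for n
    unfolding G_def by (intro suminf_nonneg r_summable r_nonneg)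
  \<comment> \<open>Summing the series over a finite set bounds each term by its total mass, hence
    gives a bound independent of \<open>F\<close>.\<close>
  have "(\<Sum>n\<in>F. G n) \<le> (\<Sum>k. C ^ k / L ^ Suc k)" if "finite F" for F
  proof (rule sums_le[OF _ sums_sum summable_sums[OF geo]])
    show "(\<lambda>k. r k n) sums G n" for n
      by (rule G_sums)
    show "(\<Sum>n\<in>F. r k n) \<le> C ^ k / L ^ Suc k" for k
      unfolding r_def sum_divide_distrib[symmetric]
      using q_fin[OF that] CL by (intro divide_right_mono) auto
  qed
  then have G_summable: "G summable_on UNIV"
    by (intro nonneg_bdd_above_summable_on bdd_aboveI2 G_nonneg) auto
  have G_eq: "L * G n = avg2 c G n + of_bool (n = 0)" for n
  proof -
    have "(\<lambda>k. avg2 c (r k) n) sums avg2 c G n"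
      unfolding avg2_def avg_def by (intro sums_sum sums_mult sums_divide sums_add G_sums)
    \<comment> \<open>Applying the operator shifts the series by one index, so the two sides of the
      equation differ only in the term for \<open>k = 0\<close>, where \<open>L * r 0 n\<close> is
      the delta.\<close>
    moreover have "avg2 c (r k) n = L * r (Suc k) n" for k
    proof -
      have "avg2 c (r k) n = avg2 c (q k) n / L ^ Suc k"
        by (simp add: avg2_def r_def[abs_def] avg_linear sum_divide_distrib del: power_Suc)
      then show ?thesis
        using CL by (simp add: r_def q_Suc)
    qed
    ultimately have "(\<lambda>k. L * r (Suc k) n) sums avg2 c G n"
      by simp
    then have "(\<lambda>k. L * r k n) sums (avg2 c G n + L * r 0 n)"
      by (subst (asm) sums_Suc_iff) simp
    moreover have "(\<lambda>k. L * r k n) sums (L * G n)"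
      by (intro sums_mult G_sums)
    ultimately show ?thesis
      using sums_unique2 CL by (fastforce simp: r_def q_def)
  qed
  have avg2_nonneg: "0 \<le> c j * avg j (avg j G) n" for j n
    by (intro mult_nonneg_nonneg avg_nonneg less_imp_le[OF c] G_nonneg)
  \<comment> \<open>The double average at distance two contains \<open>G n\<close> with weight 1/4,
    and nonnegativity of the other terms excludes cancellation.\<close>
  have G_step: "0 < G (n + axis j 2)" if "0 < G n" for n j
  proof -
    have ax: "axis j (2::int) = axis j 1 + axis j 1"
      by (simp add: axis_def vec_eq_iff)
    have "avg j (avg j G) (n + axis j 2)
        = G n / 4 + G (n + axis j 2) / 2 + G (n + axis j 2 + axis j 2) / 4"
      by (simp add: avg_def ax add_divide_distrib diff_add_eq_diff_diff_swap algebra_simps)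
    then have "G n / 4 \<le> avg j (avg j G) (n + axis j 2)"
      using G_nonneg[of "n + axis j 2"] G_nonneg[of "n + axis j 2 + axis j 2"] by simp
    then have "0 < c j * avg j (avg j G) (n + axis j 2)"
      using that c by (intro mult_pos_pos) (auto intro: less_le_trans[rotated])
    also have "\<dots> \<le> avg2 c G (n + axis j 2)"
      unfolding avg2_def using avg2_nonneg by (intro member_le_sum) auto
    also have "\<dots> \<le> L * G (n + axis j 2)"
      by (simp add: G_eq)
    finally show ?thesis
      using CL by (simp add: zero_less_mult_iff)
  qed
  have "0 < G (axis j (2 * int m))" for j m
  proof (induction m)
    case 0
    \<comment> \<open>At the origin the source contributes 1, which starts the propagation of
      positivity.\<close>
    have "0 < avg2 c G 0 + of_bool (0 = (0::int^3))"
      unfolding avg2_def using avg2_nonneg by (simp add: add_nonneg_pos sum_nonneg)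
    then have "0 < L * G 0"
      unfolding G_eq[symmetric] .
    then have "0 < G 0"
      using CL by (simp add: zero_less_mult_iff)
    moreover have "axis j (2 * int 0) = 0"
      by simp
    ultimately show ?case
      by metis
  next
    case (Suc m)
    have "axis j (2 * int (Suc m)) = axis j (2 * int m) + axis j 2"
      by (simp add: axis_def vec_eq_iff)
    then show ?case
      using G_step[OF Suc] by simp
  qed
  then show ?thesis
    using that G_nonneg G_summable G_eq by blast
qed

section \<open>Conjugation by the phase and the real curl\<close>

definition phase :: "int^3 \<Rightarrow> complex" where
  "phase n = \<i> powi (n$1 + n$2 + n$3)"

lemma norm_phase [simp]: "norm (phase n) = 1"
  by (simp add: phase_def norm_power_int)

text \<open>The opposite signs of the two factors turn the difference in \<open>y_hat\<close> into a
  sum, and the common \<open>\<i>\<close> cancels the one in its denominator.\<close>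

lemma phase_shift:
  "phase (n + axis j 1) = \<i> * phase n" "phase (n - axis j 1) = - \<i> * phase n"
proof -
  have "(n + axis j 1)$1 + (n + axis j 1)$2 + (n + axis j 1)$3 = 1 + (n$1 + n$2 + n$3)"
    "(n - axis j 1)$1 + (n - axis j 1)$2 + (n - axis j 1)$3 = - 1 + (n$1 + n$2 + n$3)"
    using exhaust_3[of j] by (auto simp: axis_def)
  then show "phase (n + axis j 1) = \<i> * phase n" "phase (n - axis j 1) = - \<i> * phase n"
    unfolding phase_def by (simp_all only: power_int_add[OF disjI1[OF complex_i_not_zero]])
      (simp_all add: power_int_minus)
qed

lemma y_hat_phase:
  "y_hat j (\<lambda>n. phase n * complex_of_real (g n)) n = phase n * complex_of_real (avg j g n)"
  by (simp add: y_hat_def phase_shift avg_def field_simps)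

text \<open>Addition in the index type \<open>3\<close> is modulo 3, so \<open>l\<close>,
  \<open>l + 1\<close>, \<open>l + 2\<close> run cyclically and one formula covers the three rows of
  \<open>M_tilde\<close>.\<close>

definition curl :: "(3 \<Rightarrow> int^3 \<Rightarrow> real) \<Rightarrow> 3 \<Rightarrow> int^3 \<Rightarrow> real" where
  "curl F l n = avg (l + 1) (F (l + 2)) n - avg (l + 2) (F (l + 1)) n"

definition phased :: "(3 \<Rightarrow> int^3 \<Rightarrow> real) \<Rightarrow> int^3 \<Rightarrow> complex^3" where
  "phased F n = (\<chi> l. phase n * complex_of_real (F l n))"

text \<open>Evaluating cyclic indices produces 0 as the name of the third component.\<close>

lemma index_3_simps: "(3::3) = 0" "(4::3) = 1" "(5::3) = 2"
  "(vector [a, b, c] :: 'a::zero^3) $ 0 = c"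
proof -
  show z: "(3::3) = 0" and "(4::3) = 1" and "(5::3) = 2"
    by simp_all
  show "(vector [a, b, c] :: 'a^3) $ 0 = c"
    unfolding z[symmetric] by (rule vector_3)
qed

lemma M_tilde_phased: "M_tilde (phased F) n = phased (curl F) n"
  by (simp add: vec_eq_iff forall_3 M_tilde_def phased_def y_hat_phase curl_def Let_def
      index_3_simps algebra_simps)


lemma phased_nth: "phased F n $ l = phase n * complex_of_real (F l n)"
  by (simp add: phased_def)

section \<open>The real Maxwell system and its transverse modes\<close>

definition maxwell_at ::
  "real^3 \<Rightarrow> real^3 \<Rightarrow> real \<Rightarrow> (3 \<Rightarrow> int^3 \<Rightarrow> real) \<Rightarrow> (3 \<Rightarrow> int^3 \<Rightarrow> real) \<Rightarrow> int^3 \<Rightarrow> bool" where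
  "maxwell_at eps mu lam E H n \<longleftrightarrow>
     (\<forall>l. eps$l * curl H l n = lam * E l n \<and> - mu$l * curl E l n = lam * H l n)"

text \<open>A real form of the failure of the Rellich property: summability will give membership in
  \<open>B0_star\<close>, and infinite support excludes vanishing outside a ball, since balls in
  \<open>l1\<close> are finite.\<close>

definition has_infinite_tail_solution :: "real^3 \<Rightarrow> real^3 \<Rightarrow> real \<Rightarrow> bool" where
  "has_infinite_tail_solution eps mu lam \<longleftrightarrow>
     (\<exists>E H. (\<forall>l. E l summable_on UNIV \<and> H l summable_on UNIV) \<and>
            finite {n. \<not> maxwell_at eps mu lam E H n} \<and>
            infinite {n. \<exists>l. E l n \<noteq> 0 \<or> H l n \<noteq> 0})"

text \<open>Electromagnetic duality: replacing \<open>(E, H)\<close> by \<open>(H, -E)\<close>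
  exchanges \<open>eps\<close> and \<open>mu\<close>. It reduces transverse magnetic modes to
  transverse electric ones.\<close>

lemma has_infinite_tail_solution_swap:
  assumes "has_infinite_tail_solution mu eps lam"
  shows "has_infinite_tail_solution eps mu lam"
proof -
  obtain E H where EH: "\<And>l. E l summable_on UNIV" "\<And>l. H l summable_on UNIV"
    "finite {n. \<not> maxwell_at mu eps lam E H n}" "infinite {n. \<exists>l. E l n \<noteq> 0 \<or> H l n \<noteq> 0}"
    using assms unfolding has_infinite_tail_solution_def by blast
  have swap: "maxwell_at eps mu lam H (\<lambda>l n. - E l n) n \<longleftrightarrow> maxwell_at mu eps lam E H n" for n
    by (auto simp: maxwell_at_def curl_def avg_linear algebra_simps)
  show ?thesis
    unfolding has_infinite_tail_solution_def
  proof (rule exI, rule exI)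
    show "(\<forall>l. H l summable_on UNIV \<and> (\<lambda>n. - E l n) summable_on UNIV) \<and>
        finite {n. \<not> maxwell_at eps mu lam H (\<lambda>l n. - E l n) n} \<and>
        infinite {n. \<exists>l. H l n \<noteq> 0 \<or> - E l n \<noteq> 0}"
      using EH by (simp add: swap summable_on_uminus disj_commute)
  qed
qed

lemma cyclic_3:
  fixes i :: 3
  shows "i + 1 + 1 = i + 2" "i + 1 + 2 = i" "i + 2 + 1 = i" "i + 2 + 2 = i + 1"
    "i \<noteq> i + 1" "i \<noteq> i + 2" "i + 1 \<noteq> i + 2"
  by (simp_all add: add.assoc index_3_simps)

lemma UNIV_cyclic_3: "UNIV = {i, i + 1, i + 2}" for i :: 3
  by (rule sym, rule card_seteq) (simp_all add: cyclic_3)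

lemma all_cyclic_3: "(\<forall>l. P l) \<longleftrightarrow> P i \<and> P (i + 1) \<and> P (i + 2)" for i :: 3
proof -
  have "(\<forall>l. P l) \<longleftrightarrow> (\<forall>l\<in>{i, i + 1, i + 2}. P l)"
    by (subst UNIV_cyclic_3[of i, symmetric]) simp
  then show ?thesis
    by simp
qed

text \<open>The hypothesis \<open>uniaxial\<close> says that the \<open>i\<close>-th component of
  \<open>beta\<close> vanishes. It makes the two remaining electric equations reduce to the same
  scalar equation, whose symbol has the left side of \<open>lam\<close> as its maximum on the
  cube.\<close>

lemma transverse_solution:
  fixes eps mu :: "real^3" and i :: 3
  defines "j \<equiv> i + 1" and "k \<equiv> i + 2"
  assumes pos: "\<And>l. 0 < eps$l" "\<And>l. 0 < mu$l"
    and uniaxial: "eps$j * mu$k = eps$k * mu$j"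
    and lam: "eps$j * mu$k + eps$k * mu$i + eps$j * mu$i < lam\<^sup>2"
  shows "has_infinite_tail_solution eps mu lam"
proof -
  have ne [simp]: "i \<noteq> j" "i \<noteq> k" "j \<noteq> k" "j \<noteq> i" "k \<noteq> i" "k \<noteq> j"
    unfolding j_def k_def using cyclic_3[of i] by metis+
  have UN: "UNIV = {i, j, k}"
    unfolding j_def k_def by (rule UNIV_cyclic_3)
  \<comment> \<open>These weights arise by eliminating \<open>H\<close> from the \<open>j\<close>-th
    electric equation and dividing by \<open>mu$j\<close>; by \<open>uniaxial\<close> the
    \<open>k\<close>-th equation divided by \<open>mu$k\<close> gives the same ones.\<close>
  define c where "c l = (if l = i then eps$j * mu$k else if l = j then eps$k * mu$i else eps$j * mu$i)" for l
  have c: "0 < c l" for l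
    by (simp add: c_def pos)
  have "(\<Sum>l\<in>UNIV. c l) < lam\<^sup>2"
    using lam by (simp add: UN c_def)
  with c obtain G where G: "\<And>n. 0 \<le> G n" "G summable_on UNIV"
    "\<And>n. lam\<^sup>2 * G n = avg2 c G n + of_bool (n = 0)" "\<And>l m. 0 < G (axis l (2 * int m))"
    using green_function by blast
  have lam0: "lam \<noteq> 0"
  proof
    assume "lam = 0"
    moreover have "0 < eps$j * mu$k + eps$k * mu$i + eps$j * mu$i"
      by (intro add_pos_pos mult_pos_pos pos)
    ultimately show False
      using lam by simp
  qed
  \<comment> \<open>Transverse electric ansatz: E is the rotated gradient, weighted by mu, of the potential G,
    which makes the i-th equation trivial; H then follows from E.\<close>
  define E where "E l = (if l = j then (\<lambda>n. - (mu$j * avg k G n))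
    else if l = k then (\<lambda>n. mu$k * avg j G n) else (\<lambda>n. 0))" for l
  define H where "H l n = - (mu$l * curl E l n) / lam" for l n
  have curl: "curl F i n = avg j (F k) n - avg k (F j) n"
    "curl F j n = avg k (F i) n - avg i (F k) n"
    "curl F k n = avg i (F j) n - avg j (F i) n" for F n
    by (simp_all only: curl_def j_def k_def cyclic_3)
  have E: "E i = (\<lambda>n. 0)" "E j = (\<lambda>n. - (mu$j * avg k G n))" "E k = (\<lambda>n. mu$k * avg j G n)"
    by (simp_all add: E_def)
  have H: "H i = (\<lambda>n. - (mu$i * (mu$k * avg j (avg j G) n + mu$j * avg k (avg k G) n)) / lam)"
    "H j = (\<lambda>n. mu$j * (mu$k * avg i (avg j G) n) / lam)"
    "H k = (\<lambda>n. mu$k * (mu$j * avg i (avg k G) n) / lam)"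
    by (simp_all add: H_def[abs_def] curl E avg_linear)
  \<comment> \<open>The ansatz contains averages of \<open>G\<close>, so the Green equation is
    averaged too; this moves the point source to the two neighbours of the origin along axis
    \<open>l\<close>.\<close>
  have wave: "lam\<^sup>2 * avg l G n = eps$j * mu$k * avg l (avg i (avg i G)) n
      + eps$k * mu$i * avg l (avg j (avg j G)) n + eps$j * mu$i * avg l (avg k (avg k G)) n"
    if "n \<noteq> axis l 1" "n \<noteq> - axis l 1" for l n
  proof -
    have "avg l (\<lambda>n. lam\<^sup>2 * G n) n = avg l (\<lambda>n. avg2 c G n + of_bool (n = 0)) n"
      by (simp add: G(3))
    moreover have "avg l (\<lambda>n. of_bool (n = 0)) n = 0"
      using that by (auto simp: avg_def add_eq_0_iff minus_equation_iff[of n])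
    ultimately show ?thesis
      by (simp add: avg_linear avg2_def[abs_def] UN c_def)
  qed
  have "maxwell_at eps mu lam E H n"
    if n: "n \<noteq> axis j 1" "n \<noteq> - axis j 1" "n \<noteq> axis k 1" "n \<noteq> - axis k 1" for n
  proof -
    have "eps$i * curl H i n = lam * E i n"
      by (simp add: curl E H avg_linear avg_commute)
    moreover have "eps$j * curl H j n = lam * E j n"
    proof -
      have "lam * (eps$j * curl H j n) = - (mu$i * (eps$j * mu$k) * avg k (avg j (avg j G)) n
          + eps$j * mu$i * mu$j * avg k (avg k (avg k G)) n
          + (eps$j * mu$k) * mu$j * avg i (avg i (avg k G)) n)"
        using lam0 by (simp add: curl H avg_linear field_simps)
      \<comment> \<open>Trading \<open>eps$j * mu$k\<close> for \<open>eps$k * mu$j\<close> exposes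
        the common factor \<open>mu$j\<close>, and what remains is the averaged Green equation along
        \<open>k\<close>.\<close>
      also have "\<dots> = - (mu$j * (lam\<^sup>2 * avg k G n))"
        unfolding wave[OF n(3,4)]
        by (simp add: uniaxial algebra_simps avg_commute)
      also have "\<dots> = lam * (lam * E j n)"
        by (simp add: E power2_eq_square)
      finally show ?thesis
        by (rule mult_left_cancel[OF lam0, THEN iffD1])
    qed
    moreover have "eps$k * curl H k n = lam * E k n"
    proof -
      have "lam * (eps$k * curl H k n) = (eps$k * mu$j) * mu$k * avg i (avg i (avg j G)) n
          + eps$k * mu$i * mu$k * avg j (avg j (avg j G)) n
          + mu$i * (eps$k * mu$j) * avg j (avg k (avg k G)) n"
        using lam0 by (simp add: curl H avg_linear field_simps)
      also have "\<dots> = mu$k * (lam\<^sup>2 * avg j G n)"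
        unfolding wave[OF n(1,2)]
        by (simp add: uniaxial[symmetric] algebra_simps avg_commute)
      also have "\<dots> = lam * (lam * E k n)"
        by (simp add: E power2_eq_square)
      finally show ?thesis
        by (rule mult_left_cancel[OF lam0, THEN iffD1])
    qed
    moreover have "- mu$l * curl E l n = lam * H l n" for l
      using lam0 by (simp add: H_def)
    ultimately show ?thesis
      unfolding maxwell_at_def all_cyclic_3[of _ i] j_def k_def by blast
  qed
  then have "{n. \<not> maxwell_at eps mu lam E H n} \<subseteq> {axis j 1, - axis j 1, axis k 1, - axis k 1}"
    by blast
  then have "finite {n. \<not> maxwell_at eps mu lam E H n}"
    by (rule finite_subset) simp
  moreover have E_summable: "E l summable_on UNIV" for l
    unfolding E_def by (auto intro!: summable_on_uminus[THEN iffD2] summable_on_cmult_right avg_summable G)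
  moreover have "H l summable_on UNIV" for l
    unfolding H_def[abs_def] curl_def divide_inverse diff_conv_add_uminus
    by (intro summable_on_uminus[THEN iffD2] summable_on_cmult_right summable_on_cmult_left summable_on_add
        avg_summable E_summable)
  moreover have "infinite {n. \<exists>l. E l n \<noteq> 0 \<or> H l n \<noteq> 0}"
  proof (rule infinite_super)
    \<comment> \<open>At the odd points of the \<open>k\<close>-axis, \<open>avg k G\<close> has the
      positive value of \<open>G\<close> at an even point as one of its two nonnegative
      contributions, so \<open>E j\<close> does not vanish there.\<close>
    let ?f = "\<lambda>m. axis k (2 * int m) + axis k 1"
    show "range ?f \<subseteq> {n. \<exists>l. E l n \<noteq> 0 \<or> H l n \<noteq> 0}"
    proof clarify
      fix m
      have "0 < avg k G (?f m)"
        using G(1)[of "?f m + axis k 1"] G(4)[of k m] by (simp add: avg_def)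
      then have "E j (?f m) \<noteq> 0"
        using pos(2)[of j] by (simp add: E)
      then show "\<exists>l. E l (?f m) \<noteq> 0 \<or> H l (?f m) \<noteq> 0"
        by blast
    qed
    have "inj ?f"
      by (auto simp: inj_def axis_eq_axis)
    then show "infinite (range ?f)"
      by (rule range_inj_infinite)
  qed
  ultimately show ?thesis
    unfolding has_infinite_tail_solution_def by blast
qed

section \<open>From real summable fields to the complex operator\<close>

lemma B0_star_if_square_summable:
  assumes "(\<lambda>n. (norm (u n))\<^sup>2) summable_on UNIV"
  shows "u \<in> B0_star"
proof -
  define S where "S = (\<Sum>\<^sub>\<infinity>n. (norm (u n))\<^sup>2)"
  have le: "(\<Sum>n | real_of_int (l1 n) < R. (norm (u n))\<^sup>2) \<le> S" for R
    unfolding S_def using assms by (intro finite_sum_le_infsum finite_l1_ball) auto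
  have "((\<lambda>R::real. S * (1 / R)) \<longlongrightarrow> S * 0) at_top"
    by (intro tendsto_mult tendsto_const tendsto_divide_0[OF tendsto_const] filterlim_at_top_imp_at_infinity
        filterlim_ident)
  then have lim: "((\<lambda>R::real. S * (1 / R)) \<longlongrightarrow> 0) at_top"
    by simp
  have "\<forall>\<^sub>F R::real in at_top.
      norm (1 / R * (\<Sum>n | real_of_int (l1 n) < R. (norm (u n))\<^sup>2)) \<le> S * (1 / R)"
    using eventually_gt_at_top[of 0]
  proof eventually_elim
    case (elim R)
    then show ?case
      using le[of R] by (simp add: abs_mult sum_nonneg divide_right_mono)
  qed
  from Lim_null_comparison[OF this lim] show ?thesis
    by (simp add: B0_star_def)
qed

text \<open>Real summability here is absolute, so \<open>f\<close> is bounded by its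
  \<open>l^1\<close> norm \<open>S\<close>, and the square is dominated by \<open>S\<close> times
  the absolute value.\<close>

lemma summable_on_power2:
  fixes f :: "'a \<Rightarrow> real"
  assumes "f summable_on A"
  shows "(\<lambda>x. (f x)\<^sup>2) summable_on A"
proof -
  have abs: "(\<lambda>x. \<bar>f x\<bar>) summable_on A"
    using assms summable_on_iff_abs_summable_on_real by auto
  define S where "S = (\<Sum>\<^sub>\<infinity>x\<in>A. \<bar>f x\<bar>)"
  have "\<bar>f x\<bar> \<le> S" if "x \<in> A" for x
    using finite_sum_le_infsum[OF abs, of "{x}"] that by (simp add: S_def)
  then have "(f x)\<^sup>2 \<le> S * \<bar>f x\<bar>" if "x \<in> A" for x
    using that by (metis abs_ge_zero mult_right_mono power2_abs power2_eq_square)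
  then show ?thesis
    by (intro summable_on_comparison_test[OF summable_on_cmult_right[OF abs, of S]]) auto
qed

lemma sum_6: "(\<Sum>i\<in>(UNIV :: 6 set). f i) = f 1 + f 2 + f 3 + f 4 + f 5 + f 6"
proof -
  have UN: "(UNIV :: 6 set) = {1, 2, 3, 4, 5, 6}"
    by (rule sym, rule card_seteq) simp_all
  show ?thesis
    unfolding UN by (simp add: add.assoc)
qed

lemma norm_join_squared: "(norm (join a b))\<^sup>2 = (\<Sum>l\<in>UNIV. (norm (a$l))\<^sup>2 + (norm (b$l))\<^sup>2)"
  for a b :: "complex^3"
  by (simp add: norm_vec_def L2_set_def sum_nonneg sum_6 sum_3)

lemma upper_join [simp]: "upper (join a b) = a"
  by (simp add: vec_eq_iff forall_3 upper_def)

lemma lower_join [simp]: "lower (join a b) = b"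
  by (simp add: vec_eq_iff forall_3 lower_def)

lemma D_hat_mult: "(D_hat eps mu *v v) $ i = complex_of_real (join eps mu $ i) * v $ i"
  by (simp add: D_hat_def matrix_vector_mult_def if_distrib[where f="\<lambda>x. x * _"] cong: if_cong)

text \<open>On phased fields \<open>M_tilde\<close> acts as \<open>curl\<close>, so every component
  of the equation is its real counterpart times the common factor \<open>phase n\<close>.\<close>

lemma HD_phased:
  assumes "maxwell_at eps mu lam E H n"
  shows "HD eps mu (\<lambda>n. join (phased E n) (phased H n)) n
    = complex_of_real lam *s join (phased E n) (phased H n)"
proof -
  have eqs: "eps$l * curl H l n = lam * E l n" "mu$l * curl E l n = - (lam * H l n)" for l
    using assms by (simp_all add: maxwell_at_def flip: minus_mult_left) (metis minus_minus)
  have "complex_of_real (eps$l) * complex_of_real (curl H l n) = complex_of_real lam * complex_of_real (E l n)"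
    "complex_of_real (mu$l) * complex_of_real (curl E l n) = - (complex_of_real lam * complex_of_real (H l n))" for l
    by (simp_all only: eqs flip: of_real_mult of_real_minus)
  then show ?thesis
    by (simp add: vec_eq_iff forall_6 HD_def D_hat_mult H0_def M_tilde_phased phased_nth
        mult.left_commute[of _ "phase n"])
qed

lemma rellich_fails:
  assumes "has_infinite_tail_solution eps mu lam"
  shows "\<exists>u \<in> B0_star.
           (\<exists>F. finite F \<and> (\<forall>n. n \<notin> F \<longrightarrow> HD eps mu u n - complex_of_real lam *s u n = 0)) \<and>
           \<not> (\<exists>R::real. R > 0 \<and> (\<forall>n. real_of_int (l1 n) > R \<longrightarrow> u n = 0))"
proof -
  obtain E H where EH: "\<And>l. E l summable_on UNIV" "\<And>l. H l summable_on UNIV"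
    "finite {n. \<not> maxwell_at eps mu lam E H n}" "infinite {n. \<exists>l. E l n \<noteq> 0 \<or> H l n \<noteq> 0}"
    using assms unfolding has_infinite_tail_solution_def by blast
  define u where "u n = join (phased E n) (phased H n)" for n
  have norm_u: "(norm (u n))\<^sup>2 = (\<Sum>l\<in>UNIV. (E l n)\<^sup>2 + (H l n)\<^sup>2)" for n
    by (simp add: u_def norm_join_squared phased_nth norm_mult)
  have "u \<in> B0_star"
    by (intro B0_star_if_square_summable)
      (simp only: norm_u sum_3, intro summable_on_add summable_on_power2 EH)
  moreover have "HD eps mu u n - complex_of_real lam *s u n = 0"
    if "n \<notin> {n. \<not> maxwell_at eps mu lam E H n}" for n
    using that HD_phased[of eps mu lam E H n] by (simp add: u_def[abs_def])
  moreover have False if "\<And>n. real_of_int (l1 n) > R \<Longrightarrow> u n = 0" for R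
  proof -
    \<comment> \<open>Vanishing beyond \<open>R\<close> only yields \<open>l1 n \<le> R\<close> on
      the support; the radius \<open>R + 1\<close> fits the strict inequality in
      \<open>finite_l1_ball\<close>.\<close>
    have "{n. \<exists>l. E l n \<noteq> 0 \<or> H l n \<noteq> 0} \<subseteq> {n. real_of_int (l1 n) < R + 1}"
    proof clarify
      fix n l
      assume "E l n \<noteq> 0 \<or> H l n \<noteq> 0"
      then have "0 < (E l n)\<^sup>2 + (H l n)\<^sup>2"
        by (simp add: sum_power2_gt_zero_iff)
      also have "\<dots> \<le> (norm (u n))\<^sup>2"
        unfolding norm_u by (rule member_le_sum) auto
      finally have "u n \<noteq> 0"
        by auto
      with that[of n] show "real_of_int (l1 n) < R + 1"
        by fastforce
    qed
    with EH(4) finite_l1_ball finite_subset show False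
      by blast
  qed
  ultimately show ?thesis
    using EH(3) by blast
qed

section \<open>The corner value of \<open>tau_minus\<close> and the choice of polarization\<close>

text \<open>With \<open>beta eps mu $ i = 0\<close> the form \<open>K0\<close> is a perfect square,
  so the root is an absolute value; the two candidates for the minimum are the coefficient sums of
  the electric and the magnetic mode symbols.\<close>

lemma tau_minus_one:
  fixes i :: 3
  defines "j \<equiv> i + 1" and "k \<equiv> i + 2"
  assumes "eps$j * mu$k = eps$k * mu$j"
  shows "tau_minus eps mu 1 = min (eps$j * mu$k + eps$k * mu$i + eps$j * mu$i)
    (mu$j * eps$k + mu$k * eps$i + mu$j * eps$i)"
proof -
  define b where "b = beta eps mu"
  have b: "b$j = eps$k * mu$i - eps$i * mu$k" "b$k = eps$i * mu$j - eps$j * mu$i" "b$i = 0"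
    using exhaust_3[of i] assms(3) unfolding j_def k_def
    by (auto simp: b_def beta_def cross3_def index_3_simps)
  have "K0 eps mu 1 = ((b$1)\<^sup>2 + (b$2)\<^sup>2 + (b$3)\<^sup>2) / 4
      - (b$1 * b$2 + b$1 * b$3 + b$2 * b$3) / 2"
    by (simp add: K0_def Let_def b_def[symmetric] sum_3)
  also have "\<dots> = ((b$j)\<^sup>2 + (b$k)\<^sup>2) / 4 - b$j * b$k / 2"
    using exhaust_3[of i] b(3) unfolding j_def k_def
    by (elim disjE) (simp_all add: index_3_simps add.commute mult.commute)
  also have "\<dots> = ((b$j - b$k) / 2)\<^sup>2"
    by (simp add: power2_eq_square field_simps)
  finally have "K0 eps mu 1 = ((b$j - b$k) / 2)\<^sup>2" .
  then have "sqrt (K0 eps mu 1) = \<bar>b$j - b$k\<bar> / 2"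
    by simp
  moreover have "Psi0 eps mu 1 = (eps$j * mu$k + eps$k * mu$j + eps$k * mu$i + eps$i * mu$k
      + eps$i * mu$j + eps$j * mu$i) / 2"
    using exhaust_3[of i] unfolding j_def k_def
    by (elim disjE) (simp_all add: Psi0_def alpha_def sum_3 index_3_simps add_divide_distrib)
  \<comment> \<open>\<open>Psi0\<close> is the mean of the two candidates and
    \<open>\<bar>b$j - b$k\<bar>\<close> their distance; the mean minus half the distance is the
    minimum.\<close>
  ultimately show ?thesis
    using assms(3) by (simp add: tau_minus_def b algebra_simps)
qed

theorem theorem1p2:
  fixes eps mu :: "real^3" and lam :: real
  assumes "\<forall>i. 0 < eps$i" and "\<forall>i. 0 < mu$i"
    and "beta eps mu \<in> B12"
    and "\<bar>lam\<bar> > lambda_minus eps mu"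
  shows "\<exists>u \<in> B0_star.
           (\<exists>F. finite F \<and> (\<forall>n. n \<notin> F \<longrightarrow> HD eps mu u n - complex_of_real lam *s u n = 0)) \<and>
           \<not> (\<exists>R::real. R > 0 \<and> (\<forall>n. real_of_int (l1 n) > R \<longrightarrow> u n = 0))"
proof (rule rellich_fails)
  have "\<exists>i. beta eps mu $ i = 0"
    using assms(3) by (auto simp: B12_def)
  then obtain i where i: "eps$(i + 1) * mu$(i + 2) = eps$(i + 2) * mu$(i + 1)"
  proof clarify
    fix i
    assume "beta eps mu $ i = 0"
    then have "eps$(i + 1) * mu$(i + 2) = eps$(i + 2) * mu$(i + 1)"
      using exhaust_3[of i] by (auto simp: beta_def cross3_def index_3_simps)
    with that show thesis .
  qed
  have "sqrt (tau_minus eps mu 1) \<le> lambda_minus eps mu"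
    by (intro lambda_minus_is_max) (simp add: unit_cube_def)
  also have "\<dots> < sqrt (lam\<^sup>2)"
    using assms(4) by simp
  finally have "tau_minus eps mu 1 < lam\<^sup>2"
    by (simp only: real_sqrt_less_iff)
  \<comment> \<open>A minimum below \<open>lam\<^sup>2\<close> means that at least one of the two
    polarizations satisfies the bound required by \<open>transverse_solution\<close>.\<close>
  with tau_minus_one[OF i]
  consider "eps$(i+1) * mu$(i+2) + eps$(i+2) * mu$i + eps$(i+1) * mu$i < lam\<^sup>2"
    | "mu$(i+1) * eps$(i+2) + mu$(i+2) * eps$i + mu$(i+1) * eps$i < lam\<^sup>2"
    by (auto simp: min_less_iff_disj)
  then show "has_infinite_tail_solution eps mu lam"
  proof cases
    case 1
    then show ?thesis
      using assms(1,2) i by (intro transverse_solution) auto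
  next
    case 2
    \<comment> \<open>The magnetic mode is the electric mode of the medium with \<open>eps\<close>
      and \<open>mu\<close> exchanged; \<open>uniaxial\<close> is symmetric under this
      exchange.\<close>
    have "has_infinite_tail_solution mu eps lam"
      using assms(1,2) i 2 by (intro transverse_solution[of mu eps i]) (auto simp: mult.commute)
    then show ?thesis
      by (rule has_infinite_tail_solution_swap)
  qed
qed

end
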